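(* Let $k,n,d,d'\ge 1$ be integers. (Invariant case.) The real vector space of invariant linear layers with bias $L:\mathbb{R}^{n^k\times d}\to\mathbb{R}^{d'}$ has dimension $dd'\,\mathrm{b}(k)+d'$. A basis is given by the tensors $B^{\lambda,j,j'}$ (purely linear part) and $C^{j'}$ (bias part), $\lambda\in[n]^k/_\sim$, $j\in[d]$, $j'\in[d']$, where $$B^{\lambda,j,j'}_{a,i,i'}=\begin{cases}1 & a\in\lambda,\ i=j,\ i'=j'\\ 0&\text{otherwise}\end{cases},\qquad C^{j'}_{i'}=\begin{cases}1& i'=j'\\0&\text{otherwise}\end{cases}$$ for $a\in[n]^k$, $i\in[d]$, $i'\in[d']$; that is, the general form of such a layer is $$L(A)_{i'}=\sum_{a,i}T_{a,i,i'}A_{a,i}+Y_{i'},\quad T=\sum_{\lambda,j,j'}w_{\lambda,j,j'}B^{\lambda,j,j'},\quad Y=\sum_{j'}b_{j'}C^{j'}$$ with real parameters $w_{\lambda,j,j'}$, $b_{j'}$. (Equivariant case.) The real vector space of equivariant linear layers with bias $L:\mathbb{R}^{n^k\times d}\to\mathbb{R}^{n^k\times d'}$ has dimension $dd'\,\mathrm{b}(2k)+d'\,\mathrm{b}(k)$. A basis is given by the tensors $B^{\mu,j,j'}$ (purely linear part) and $C^{\lambda,j'}$ (bias part), $\mu\in[n]^{2k}/_\sim$, $\lambda\in[n]^k/_\sim$, $j\in[d]$, $j'\in[d']$, where $$B^{\mu,j,j'}_{a,i,b,i'}=\begin{cases}1 & (a,b)\in\mu,\ i=j,\ i'=j'\\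 0&\text{otherwise}\end{cases},\qquad C^{\lambda,j'}_{b,i'}=\begin{cases}1& b\in\lambda,\ i'=j'\\0&\text{otherwise}\end{cases}$$ for $a,b\in[n]^k$, $i\in[d]$, $i'\in[d']$; that is, the general form of such a layer is $$L(A)_{b,i'}=\sum_{a,i}T_{a,i,b,i'}A_{a,i}+Y_{b,i'},\quad T=\sum_{\mu,j,j'}w_{\mu,j,j'}B^{\mu,j,j'},\quad Y=\sum_{\lambda,j'}b_{\lambda,j'}C^{\lambda,j'}$$ with real parameters $w_{\mu,j,j'}$, $b_{\lambda,j'}$.
   Context: $[n]=\{1,\dots,n\}$. $\mathbb{R}^{n^k\times d}$ is the space of real tensors $A=(A_{a,i})$ with $a\in[n]^k$ and feature index $i\in[d]$. A permutation $p$ of $[n]$, with permutation matrix $P$, acts only on the first $k$ (nodal) indices: the $(p(i_1),\dots,p(i_k),i)$-th entry of $P\star A$ equals the $(i_1,\dots,i_k,i)$-th entry of $A$. A "linear layer with bias" is an affine map (a linear map plus a constant). It is invariant (for target $\mathbb{R}^{d'}$) if $L(P\star A)=L(A)$ for all $A$ and all permutation matrices $P$, and equivariant (for target $\mathbb{R}^{n^k\times d'}$) if $L(P\star A)=P\star L(A)$ for all $A$ and all permutation matrices $P$. For $\ell\ge1$, multi-indices $a,b\in[n]^\ell$ satisfy $a\sim b$ iff they have the same equality pattern: $a_i=a_j\Leftrightarrow b_i=b_j$ for all $i,j\in[\ell]$. $[n]^\ell/_\sim$ is the set of equivalence classes. $\mathrm{b}(\ell)$ is the $\ell$-th Bell number,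 the number of partitions of a set with $\ell$ elements. $[n]^k\times[n]^k$ is identified with $[n]^{2k}$ by concatenation.
   Formalization: The Bell-number dimension formulas are stated only for k ≤ n (invariant) and 2k ≤ n (equivariant), since they fail otherwise (k=2, n=d=d'=1: dimension 2, not 3); for all n the dimension is given with |[n]^k/~| and |[n]^{2k}/~| in place of b(k) and b(2k). *)

theory Defs
  imports "HOL-Analysis.Analysis" "HOL-Library.Function_Algebras" "HOL-Library.Disjoint_Sets"
begin

text \<open>
  Pointwise scalar multiplication completes the pointwise addition of
  \<^theory>\<open>HOL-Library.Function_Algebras\<close>: the functions into a real vector space form a real vector
  space, so that \<^const>\<open>span\<close>, \<^const>\<open>independent\<close> and \<^const>\<open>dim\<close> apply to spaces of layers.
\<close>

instantiation "fun" :: (type, real_vector) real_vector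
begin

definition scaleR_fun :: "real \<Rightarrow> ('a \<Rightarrow> 'b) \<Rightarrow> 'a \<Rightarrow> 'b" where
  "scaleR_fun c f = (\<lambda>x. c *\<^sub>R f x)"

instance
  by standard (simp_all add: scaleR_fun_def fun_eq_iff scaleR_add_right scaleR_add_left)

end

text \<open>
  The sets $[n]$, $[k]$, $[d]$, $[d']$ are the finite types \<open>'n\<close>, \<open>'k\<close>, \<open>'d\<close>, \<open>'e\<close>. A multi-index
  in $[n]^k$ is a function \<open>'k \<Rightarrow> 'n\<close>, and $[n]^{2k}$ is \<open>'k + 'k \<Rightarrow> 'n\<close>, where the concatenation of
  \<open>a\<close> and \<open>b\<close> is \<^term>\<open>case_sum a b\<close>. A tensor in $R^{n^k \times d}$ has type
  \<open>real^'d^('k \<Rightarrow> 'n)\<close>, its entry at \<open>(a, i)\<close> being \<open>A $ a $ i\<close>.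
\<close>

definition act :: "('n \<Rightarrow> 'n) \<Rightarrow> 'a ^ ('k::finite \<Rightarrow> 'n::finite) \<Rightarrow> 'a ^ ('k \<Rightarrow> 'n)" where
  "act p A = (\<chi> a. A $ (inv p \<circ> a))"

lemma act_nth: "bij p \<Longrightarrow> act p A $ (p \<circ> a) = A $ a"
  by (simp add: act_def o_assoc inv_o_cancel bij_is_inj)

definition affine_map :: "('a::real_vector \<Rightarrow> 'b::real_vector) \<Rightarrow> bool" where
  "affine_map L \<longleftrightarrow> (\<exists>f c. linear f \<and> L = (\<lambda>A. f A + c))"

definition invariant_layers ::
  "(real ^ 'd::finite ^ ('k::finite \<Rightarrow> 'n::finite) \<Rightarrow> real ^ 'e::finite) set" where
  "invariant_layers = {L. affine_map L \<and> (\<forall>p A. bij p \<longrightarrow> L (act p A) = L A)}"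

definition equivariant_layers ::
  "(real ^ 'd::finite ^ ('k::finite \<Rightarrow> 'n::finite) \<Rightarrow> real ^ 'e::finite ^ ('k \<Rightarrow> 'n)) set" where
  "equivariant_layers = {L. affine_map L \<and> (\<forall>p A. bij p \<longrightarrow> L (act p A) = act p (L A))}"

definition same_pattern :: "(('l \<Rightarrow> 'n) \<times> ('l \<Rightarrow> 'n)) set" where
  "same_pattern = {(a, b). \<forall>i j. a i = a j \<longleftrightarrow> b i = b j}"

definition pattern_classes :: "('l \<Rightarrow> 'n) set set" where
  "pattern_classes = UNIV // same_pattern"

definition Bell :: "nat \<Rightarrow> nat" where
  "Bell l = card {P. partition_on {1..l} P}"

text \<open>An indexed family (hence the injectivity) that is a basis of the subspace \<open>V\<close>.\<close>

definition basis_of :: "('i \<Rightarrow> 'v::real_vector) \<Rightarrow> 'i set \<Rightarrow> 'v set \<Rightarrow> bool" where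
  "basis_of b I V \<longleftrightarrow> inj_on b I \<and> independent (b ` I) \<and> span (b ` I) = V"

definition inv_B ::
  "('k \<Rightarrow> 'n) set \<Rightarrow> 'd \<Rightarrow> 'e \<Rightarrow> real ^ 'e::finite ^ 'd::finite ^ ('k::finite \<Rightarrow> 'n::finite)" where
  "inv_B l j j' = (\<chi> a i i'. if a \<in> l \<and> i = j \<and> i' = j' then 1 else 0)"

definition inv_C :: "'e \<Rightarrow> real ^ 'e::finite" where
  "inv_C j' = (\<chi> i'. if i' = j' then 1 else 0)"

definition inv_layer ::
  "real ^ 'e::finite ^ 'd::finite ^ ('k::finite \<Rightarrow> 'n::finite) \<Rightarrow> real ^ 'e
    \<Rightarrow> real ^ 'd ^ ('k \<Rightarrow> 'n) \<Rightarrow> real ^ 'e" where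
  "inv_layer T Y A = (\<chi> i'. (\<Sum>a\<in>UNIV. \<Sum>i\<in>UNIV. T $ a $ i $ i' * A $ a $ i) + Y $ i')"

fun inv_basis ::
  "(('k \<Rightarrow> 'n) set \<times> 'd \<times> 'e) + 'e
    \<Rightarrow> real ^ 'd::finite ^ ('k::finite \<Rightarrow> 'n::finite) \<Rightarrow> real ^ 'e::finite" where
  "inv_basis (Inl (l, j, j')) = inv_layer (inv_B l j j') 0"
| "inv_basis (Inr j') = inv_layer 0 (inv_C j')"

definition equiv_B ::
  "('k + 'k \<Rightarrow> 'n) set \<Rightarrow> 'd \<Rightarrow> 'e
    \<Rightarrow> real ^ 'e::finite ^ ('k \<Rightarrow> 'n) ^ 'd::finite ^ ('k::finite \<Rightarrow> 'n::finite)" where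
  "equiv_B m j j' =
    (\<chi> a i b i'. if case_sum a b \<in> m \<and> i = j \<and> i' = j' then 1 else 0)"

definition equiv_C ::
  "('k \<Rightarrow> 'n) set \<Rightarrow> 'e \<Rightarrow> real ^ 'e::finite ^ ('k::finite \<Rightarrow> 'n::finite)" where
  "equiv_C l j' = (\<chi> b i'. if b \<in> l \<and> i' = j' then 1 else 0)"

definition equiv_layer ::
  "real ^ 'e::finite ^ ('k \<Rightarrow> 'n) ^ 'd::finite ^ ('k::finite \<Rightarrow> 'n::finite) \<Rightarrow> real ^ 'e ^ ('k \<Rightarrow> 'n)
    \<Rightarrow> real ^ 'd ^ ('k \<Rightarrow> 'n) \<Rightarrow> real ^ 'e ^ ('k \<Rightarrow> 'n)" where
  "equiv_layer T Y A =
    (\<chi> b i'. (\<Sum>a\<in>UNIV. \<Sum>i\<in>UNIV. T $ a $ i $ b $ i' * A $ a $ i) + Y $ b $ i')"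

fun equiv_basis ::
  "(('k + 'k \<Rightarrow> 'n) set \<times> 'd \<times> 'e) + (('k \<Rightarrow> 'n) set \<times> 'e)
    \<Rightarrow> real ^ 'd::finite ^ ('k::finite \<Rightarrow> 'n::finite) \<Rightarrow> real ^ 'e::finite ^ ('k \<Rightarrow> 'n)" where
  "equiv_basis (Inl (m, j, j')) = equiv_layer (equiv_B m j j') 0"
| "equiv_basis (Inr (l, j')) = equiv_layer 0 (equiv_C l j')"

end

theory Submission
  imports Defs
begin

text \<open>
  An affine layer determines its weight and bias tensors, so invariance of the layer amounts to
  invariance of the two tensors under permutations of the values of the multi-indices. Because a
  bijection between the value sets of two multi-indices extends to a permutation of the finite set
  \<open>'n\<close>, the orbits are the equality patterns. Hence the invariant tensors are those constant on
  patterns, and the indicator tensors of the patterns form a basis of them. A pattern is given by the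
  partition of the positions into level sets, and every partition occurs if there are enough values.
\<close>

section \<open>Equality patterns\<close>

lemma equiv_same_pattern: "equiv UNIV same_pattern"
  by (auto simp: same_pattern_def equiv_def refl_on_def sym_def trans_def)

lemma same_patternD: "(a, b) \<in> same_pattern \<Longrightarrow> a i = a j \<longleftrightarrow> b i = b j"
  by (simp add: same_pattern_def)

lemma same_pattern_iff_perm:
  fixes a b :: "'l \<Rightarrow> 'n::finite"
  shows "(a, b) \<in> same_pattern \<longleftrightarrow> (\<exists>p. bij p \<and> b = p \<circ> a)"
proof
  assume ab: "(a, b) \<in> same_pattern"
  \<comment> \<open>Each value of \<open>a\<close> is sent to the matching value of
    \<open>b\<close>. Which preimage \<open>inv a\<close> picks is immaterial, because
    \<open>b\<close> is constant on the level sets of \<open>a\<close>.\<close>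
  define g where "g x = b (inv a x)" for x
  have ga: "g (a i) = b i" for i
    unfolding g_def using same_patternD[OF ab] by (metis f_inv_into_f rangeI)
  have g: "bij_betw g (range a) (range b)"
    using same_patternD[OF ab] by (auto simp: bij_betw_def inj_on_def ga image_image)
  \<comment> \<open>As \<open>'n\<close> is finite, equally many values are left over on both sides,
    so some bijection \<open>h\<close> of the complements completes \<open>g\<close> to a
    permutation.\<close>
  have "card (- range a) = card (- range b)"
    using bij_betw_same_card[OF g] by (simp add: Compl_eq_Diff_UNIV card_Diff_subset)
  then obtain h where h: "bij_betw h (- range a) (- range b)"
    using finite_same_card_bij by (metis finite)
  let ?p = "\<lambda>x. if x \<in> range a then g x else h x"
  have "bij_betw ?p (range a \<union> - range a) (range b \<union> - range b)"
    by (rule bij_betw_disjoint_Un[OF g h]) auto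
  moreover have "b = ?p \<circ> a"
    by (simp add: fun_eq_iff ga)
  ultimately show "\<exists>p. bij p \<and> b = p \<circ> a"
    by (metis Un_commute Compl_partition2)
next
  assume "\<exists>p. bij p \<and> b = p \<circ> a"
  then show "(a, b) \<in> same_pattern"
    by (auto simp: same_pattern_def bij_def inj_def)
qed

lemma pattern_classesE:
  assumes "X \<in> pattern_classes"
  obtains a where "X = same_pattern `` {a}"
  using assms by (auto simp: pattern_classes_def elim: quotientE)

lemma pattern_class_in [simp]: "same_pattern `` {a} \<in> pattern_classes"
  by (simp add: pattern_classes_def quotientI)

text \<open>Distinct classes are disjoint, so membership can be rephrased as an equation, the form
  that \<open>sum.delta\<close> requires.\<close>

lemma mem_pattern_class_iff:
  assumes "X \<in> pattern_classes"
  shows "a \<in> X \<longleftrightarrow> X = same_pattern `` {a}"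
  using assms
  by (elim pattern_classesE)
    (use equiv_class_eq_iff[OF equiv_same_pattern] in auto)

lemma sum_pattern_classes_delta:
  fixes a :: "'l::finite \<Rightarrow> 'n::finite"
  shows "(\<Sum>X\<in>pattern_classes. if a \<in> X then f X else (0::'b::comm_monoid_add))
    = f (same_pattern `` {a})"
proof -
  have "(\<Sum>X\<in>pattern_classes. if a \<in> X then f X else 0)
    = (\<Sum>X\<in>pattern_classes. if X = same_pattern `` {a} then f X else 0)"
    by (rule sum.cong) (simp_all add: mem_pattern_class_iff)
  also have "\<dots> = f (same_pattern `` {a})"
    by (subst sum.delta) auto
  finally show ?thesis .
qed

text \<open>The chosen representative differs from \<open>a\<close> only by a permutation. This lets
  the coefficient of a class be read off at an arbitrary member.\<close>

lemma perm_invariant_on_class: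
  fixes a :: "'l \<Rightarrow> 'n::finite"
  assumes "\<And>p a. bij p \<Longrightarrow> f (p \<circ> a) = f a"
  shows "f (SOME b. b \<in> same_pattern `` {a}) = f a"
proof -
  have "(SOME b. b \<in> same_pattern `` {a}) \<in> same_pattern `` {a}"
    by (rule someI[of _ a]) (simp add: same_pattern_def)
  then show ?thesis
    using assms by (auto simp: same_pattern_iff_perm)
qed

lemma pattern_class_perm:
  fixes a :: "'l \<Rightarrow> 'n::finite"
  assumes "bij p"
  shows "same_pattern `` {p \<circ> a} = same_pattern `` {a}"
  using assms equiv_class_eq[OF equiv_same_pattern]
  by (metis same_pattern_iff_perm)

section \<open>Counting patterns by set partitions\<close>

definition kernel_partition :: "('l \<Rightarrow> 'n) \<Rightarrow> 'l set set" where
  "kernel_partition a = UNIV // {(i, j). a i = a j}"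

lemma partition_on_kernel: "partition_on UNIV (kernel_partition a)"
  unfolding kernel_partition_def
  by (rule partition_on_quotient) (auto simp: equiv_def refl_on_def sym_def trans_def)

lemma eq_iff_kernel_partition: "a i = a j \<longleftrightarrow> (\<exists>X\<in>kernel_partition a. i \<in> X \<and> j \<in> X)"
  by (auto simp: kernel_partition_def quotient_def)

text \<open>Two positions carry equal values iff they share a block, so the partition into level
  sets is a complete invariant of the pattern.\<close>

lemma kernel_partition_eq_iff:
  "kernel_partition a = kernel_partition b \<longleftrightarrow> same_pattern `` {a} = same_pattern `` {b}"
proof -
  have "kernel_partition a = kernel_partition b \<longleftrightarrow> (a, b) \<in> same_pattern"
  proof
    assume "kernel_partition a = kernel_partition b"
    then show "(a, b) \<in> same_pattern"
      by (simp add: same_pattern_def eq_iff_kernel_partition[of a] eq_iff_kernel_partition[of b])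
  next
    assume "(a, b) \<in> same_pattern"
    then show "kernel_partition a = kernel_partition b"
      by (simp add: kernel_partition_def same_pattern_def)
  qed
  then show ?thesis
    by (simp add: eq_equiv_class_iff[OF equiv_same_pattern])
qed

text \<open>With at least as many values as positions, the blocks of any partition can be labelled
  by distinct values. With fewer values, the partition into singletons is not reached.\<close>

lemma range_kernel_partition:
  assumes "CARD('l::finite) \<le> CARD('n::finite)"
  shows "range (kernel_partition :: ('l \<Rightarrow> 'n) \<Rightarrow> _) = {P. partition_on UNIV P}"
proof (intro equalityI subsetI)
  fix P :: "'l set set"
  assume "P \<in> {P. partition_on UNIV P}"
  then obtain r where r: "equiv UNIV r" "P = UNIV // r"
    by (auto simp: partition_on_alt)
  obtain f :: "'l \<Rightarrow> 'n" where f: "inj f"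
    using card_le_inj[of "UNIV :: 'l set" "UNIV :: 'n set"] assms by auto
  \<comment> \<open>The representative chosen for \<open>i\<close> depends only on its block, and
    the injection \<open>f\<close> gives distinct blocks distinct values.\<close>
  define a where "a i = f (SOME j. j \<in> r `` {i})" for i
  have some: "(i, SOME j. j \<in> r `` {i}) \<in> r" for i
    using r(1) by (metis ImageE Image_singleton_iff equiv_class_self iso_tuple_UNIV_I someI_ex)
  have "a i = a j \<longleftrightarrow> (i, j) \<in> r" for i j
  proof
    assume "a i = a j"
    then have "(SOME j. j \<in> r `` {i}) = (SOME k. k \<in> r `` {j})"
      using f by (simp add: a_def inj_def)
    then show "(i, j) \<in> r"
      using some[of i] some[of j] r(1) by (metis equivE symD transD)
  next
    assume "(i, j) \<in> r"
    then show "a i = a j"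
      using r(1) by (simp add: a_def equiv_class_eq)
  qed
  then have "kernel_partition a = P"
    by (simp add: kernel_partition_def r(2))
  then show "P \<in> range (kernel_partition :: ('l \<Rightarrow> 'n) \<Rightarrow> _)"
    by blast
qed (auto simp: partition_on_kernel)

text \<open>An enumeration of the positions carries partitions to partitions of
  \<open>{1..CARD('l)}\<close> by taking images of blocks.\<close>

lemma card_partitions_eq_Bell: "card {P. partition_on (UNIV :: 'l::finite set) P} = Bell CARD('l)"
proof -
  obtain f :: "'l \<Rightarrow> nat" where f: "bij_betw f UNIV {1..CARD('l)}"
    using finite_same_card_bij[of "UNIV :: 'l set" "{1..CARD('l)}"] by auto
  define g where "g = inv_into UNIV f"
  have g: "bij_betw g {1..CARD('l)} UNIV"
    unfolding g_def using f by (rule bij_betw_inv_into)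
  have gf: "g (f x) = x" for x
    unfolding g_def using f by (simp add: bij_betw_def)
  have fg: "f (g x) = x" if "x \<in> {1..CARD('l)}" for x
    unfolding g_def using f that by (simp add: bij_betw_inv_into_right)
  have "bij_betw (image (image f)) {P. partition_on UNIV P} {P. partition_on {1..CARD('l)} P}"
  proof (rule bij_betw_byWitness[where f' = "image (image g)"])
    show "\<forall>P\<in>{P. partition_on UNIV P}. image g ` (image f ` P) = P"
      by (simp add: image_image gf)
    show "\<forall>P\<in>{P. partition_on {1..CARD('l)} P}. image f ` (image g ` P) = P"
    proof
      fix P
      assume "P \<in> {P. partition_on {1..CARD('l)} P}"
      then have "X \<subseteq> {1..CARD('l)}" if "X \<in> P" for X
        using that partition_onD1 by blast
      then have "f ` g ` X = X" if "X \<in> P" for X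
        using that fg by (force simp: image_image)
      then show "image f ` (image g ` P) = P"
        by (simp add: image_image)
    qed
    show "image (image f) ` {P. partition_on UNIV P} \<subseteq> {P. partition_on {1..CARD('l)} P}"
    proof safe
      fix P :: "'l set set"
      assume "partition_on UNIV P"
      \<comment> \<open>\<open>partition_on_inj_image\<close> deletes the empty set from the image;
        as no block is empty, nothing is lost.\<close>
      then have "partition_on (f ` UNIV) (image f ` P - {{}})"
        using f by (intro partition_on_inj_image) (auto simp: bij_betw_def)
      moreover have "{} \<notin> image f ` P"
        using partition_onD3[OF \<open>partition_on UNIV P\<close>] by auto
      ultimately show "partition_on {1..CARD('l)} (image f ` P)"
        using f by (simp add: bij_betw_def)
    qed
    show "image (image g) ` {P. partition_on {1..CARD('l)} P} \<subseteq> {P. partition_on UNIV P}"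
    proof safe
      fix P :: "nat set set"
      assume P: "partition_on {1..CARD('l)} P"
      then have "partition_on (g ` {1..CARD('l)}) (image g ` P - {{}})"
        using g P by (intro partition_on_inj_image) (auto simp: bij_betw_def)
      moreover have "{} \<notin> image g ` P"
        using partition_onD3[OF P] by auto
      ultimately show "partition_on UNIV (image g ` P)"
        using g by (simp add: bij_betw_def)
    qed
  qed
  then show ?thesis
    by (simp add: Bell_def bij_betw_same_card)
qed

lemma card_pattern_classes:
  assumes "CARD('l::finite) \<le> CARD('n::finite)"
  shows "card (pattern_classes :: ('l \<Rightarrow> 'n) set set) = Bell CARD('l)"
proof -
  have "pattern_classes = range (\<lambda>a :: 'l \<Rightarrow> 'n. same_pattern `` {a})"
    by (auto simp: pattern_classes_def quotient_def)
  also have "card \<dots> = card (range (kernel_partition :: ('l \<Rightarrow> 'n) \<Rightarrow> _))"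
  proof (rule bij_betw_same_card)
    \<comment> \<open>\<open>kernel_partition\<close> descends to classes: well-definedness and
      injectivity are the two directions of \<open>kernel_partition_eq_iff\<close>.\<close>
    let ?h = "\<lambda>X. kernel_partition (SOME a :: 'l \<Rightarrow> 'n. X = same_pattern `` {a})"
    have h: "?h (same_pattern `` {a}) = kernel_partition a" for a
      unfolding kernel_partition_eq_iff by (metis (mono_tags, lifting) someI_ex)
    show "bij_betw ?h (range (\<lambda>a. same_pattern `` {a}))
      (range (kernel_partition :: ('l \<Rightarrow> 'n) \<Rightarrow> _))"
    proof (rule bij_betw_imageI)
      show "inj_on ?h (range (\<lambda>a. same_pattern `` {a}))"
      proof (rule inj_onI, elim rangeE)
        fix X Y a b
        assume XY: "X = same_pattern `` {a}" "Y = same_pattern `` {b}" and "?h X = ?h Y"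
        then have "kernel_partition a = kernel_partition b"
          by (simp only: h)
        then show "X = Y"
          unfolding XY kernel_partition_eq_iff .
      qed
      show "?h ` range (\<lambda>a. same_pattern `` {a})
        = range (kernel_partition :: ('l \<Rightarrow> 'n) \<Rightarrow> _)"
        by (simp only: image_image h)
    qed
  qed
  finally show ?thesis
    by (simp add: range_kernel_partition[OF assms] card_partitions_eq_Bell)
qed

section \<open>Bases from unique coordinates\<close>

text \<open>Coefficients are indexed by \<open>I\<close> and not by the set of vectors, so
  \<open>zero\<close> excludes repeated vectors as well as linear dependence.\<close>

lemma basis_ofI:
  assumes I: "finite I"
    and zero: "\<And>w i. (\<Sum>i\<in>I. w i *\<^sub>R b i) = 0 \<Longrightarrow> i \<in> I \<Longrightarrow> w i = 0"
    and V: "V = range (\<lambda>w. \<Sum>i\<in>I. w i *\<^sub>R b i)"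
  shows "basis_of b I V"
proof -
  have inj: "inj_on b I"
  proof (rule inj_onI, rule ccontr)
    fix i j
    assume ij: "i \<in> I" "j \<in> I" "b i = b j" "i \<noteq> j"
    \<comment> \<open>If two vectors coincided, the coefficients 1 at \<open>i\<close> and -1 at
      \<open>j\<close> would give a vanishing combination.\<close>
    let ?w = "\<lambda>x. (if x = i then 1 else 0) - (if x = j then 1 else 0) :: real"
    have "(\<Sum>x\<in>I. ?w x *\<^sub>R b x)
      = (\<Sum>x\<in>I. (if x = i then b x else 0)) - (\<Sum>x\<in>I. if x = j then b x else 0)"
      unfolding sum_subtractf[symmetric] by (rule sum.cong) (auto simp: scaleR_diff_left)
    also have "\<dots> = 0"
      using I ij by simp
    finally have "?w i = 0"
      using ij by (intro zero) auto
    then show False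
      using ij by simp
  qed
  have sum_image: "(\<Sum>v\<in>b ` I. u v *\<^sub>R v) = (\<Sum>i\<in>I. u (b i) *\<^sub>R b i)" for u
    by (simp add: sum.reindex[OF inj])
  have "independent (b ` I)"
    using I zero[of "\<lambda>i. u (b i)" for u] by (auto simp: dependent_finite sum_image)
  moreover have "span (b ` I) = V"
  proof -
    have "span (b ` I) = range (\<lambda>u. \<Sum>i\<in>I. u (b i) *\<^sub>R b i)"
      using I by (simp add: span_finite sum_image)
    also have "\<dots> = V"
    proof -
      \<comment> \<open>Coefficients over the image may depend only on the vector
        \<open>b i\<close>; by injectivity every family \<open>w\<close> on \<open>I\<close> can be
        written that way.\<close>
      have "(\<Sum>i\<in>I. w i *\<^sub>R b i) = (\<Sum>i\<in>I. w (inv_into I b (b i)) *\<^sub>R b i)" for w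
        using inj by (intro sum.cong) auto
      then show ?thesis
        unfolding V by (auto intro!: image_eqI[where x = "w \<circ> inv_into I b" for w])
    qed
    finally show ?thesis .
  qed
  ultimately show ?thesis
    using inj by (simp add: basis_of_def)
qed

lemma dim_basis_of: "basis_of b I V \<Longrightarrow> dim V = card I"
  unfolding basis_of_def
  by (metis card_image dim_eq_card span_span)

section \<open>Affine maps between tensor spaces\<close>

lemma act_component [simp]: "act p A $ a = A $ (inv p \<circ> a)"
  by (simp add: act_def)

text \<open>Substituting \<open>p \<circ> a\<close> for \<open>a\<close> moves the permutation from
  the tensor to the coefficients.\<close>

lemma sum_act:
  fixes A :: "'a ^ ('k::finite \<Rightarrow> 'n::finite)"
  assumes "bij p"
  shows "(\<Sum>a\<in>UNIV. g a (act p A $ a)) = (\<Sum>a\<in>UNIV. g (p \<circ> a) (A $ a))"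
proof (rule sum.reindex_bij_witness[where i = "\<lambda>a. p \<circ> a" and j = "\<lambda>a. inv p \<circ> a"])
qed (use assms in \<open>auto simp: o_assoc inv_o_cancel bij_is_inj surj_iff[THEN iffD1, OF bij_is_surj]\<close>)

lemma matrix_expansion:
  fixes A :: "real ^ 'd::finite ^ 'x::finite"
  shows "A = (\<Sum>a\<in>UNIV. \<Sum>i\<in>UNIV. A $ a $ i *\<^sub>R axis a (axis i 1))"
  by (simp add: vec_eq_iff axis_def if_distrib if_distribR sum.If_cases cong: if_cong)

text \<open>A unit tensor isolates one coefficient; this is how weights are recovered from a
  layer.\<close>

lemma sum_axis_axis:
  fixes t :: "'x::finite \<Rightarrow> 'd::finite \<Rightarrow> real"
  shows "(\<Sum>a\<in>UNIV. \<Sum>i\<in>UNIV. t a i * axis x (axis j 1) $ a $ i) = t x j"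
proof -
  have "(\<Sum>a\<in>UNIV. \<Sum>i\<in>UNIV. t a i * axis x (axis j 1) $ a $ i)
    = (\<Sum>a\<in>UNIV. if a = x then t a j else 0)"
    by (rule sum.cong) (auto simp: axis_def if_distrib cong: if_cong)
  then show ?thesis
    by simp
qed

section \<open>Invariant layers\<close>

lemma inv_layer_component:
  "inv_layer T Y A $ i' = (\<Sum>a\<in>UNIV. \<Sum>i\<in>UNIV. T $ a $ i $ i' * A $ a $ i) + Y $ i'"
  by (simp add: inv_layer_def)

lemma inv_layer_split: "inv_layer T Y = inv_layer T 0 + inv_layer 0 Y"
  by (simp add: fun_eq_iff vec_eq_iff inv_layer_component)

lemma linear_inv_layer_weight: "linear (\<lambda>T. inv_layer T 0)"
  by (rule linearI)
    (simp_all add: fun_eq_iff vec_eq_iff inv_layer_component scaleR_fun_def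
      distrib_right sum.distrib sum_distrib_left mult.assoc)

lemma linear_inv_layer_bias: "linear (inv_layer 0)"
  by (rule linearI) (simp_all add: fun_eq_iff vec_eq_iff inv_layer_component scaleR_fun_def)

lemma inv_layer_zero: "inv_layer 0 0 = 0"
  by (simp add: fun_eq_iff vec_eq_iff inv_layer_component)

text \<open>The value at 0 is the bias, and the values at unit tensors then give the weights.
  Symmetries of a layer thus become symmetries of its tensors.\<close>

lemma inv_layer_eq_iff: "inv_layer T Y = inv_layer T' Y' \<longleftrightarrow> T = T' \<and> Y = Y'"
proof
  assume eq: "inv_layer T Y = inv_layer T' Y'"
  have "Y = Y'"
    using fun_cong[OF eq, of 0] by (simp add: vec_eq_iff inv_layer_component)
  moreover have "T $ a $ i $ i' = T' $ a $ i $ i'" for a i i'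
    using arg_cong[OF fun_cong[OF eq, of "axis a (axis i 1)"], of "\<lambda>v. v $ i'"] \<open>Y = Y'\<close>
    by (simp add: inv_layer_component sum_axis_axis)
  ultimately show "T = T' \<and> Y = Y'"
    by (simp add: vec_eq_iff)
qed simp

lemma affine_map_inv_layer: "affine_map (inv_layer T Y)"
  unfolding affine_map_def
proof (intro exI conjI)
  show "linear (inv_layer T 0)"
    by (rule linearI)
      (simp_all add: vec_eq_iff inv_layer_component distrib_left sum.distrib sum_distrib_left
        mult.left_commute)
  show "inv_layer T Y = (\<lambda>A. inv_layer T 0 A + Y)"
    by (simp add: fun_eq_iff vec_eq_iff inv_layer_component)
qed

text \<open>The linear part is determined by its values on the unit tensors, which serve as the
  weights.\<close>

lemma affine_mapE:
  fixes L :: "real ^ 'd::finite ^ ('k::finite \<Rightarrow> 'n::finite) \<Rightarrow> real ^ 'e::finite"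
  assumes "affine_map L"
  obtains T Y where "L = inv_layer T Y"
proof -
  obtain f c where f: "linear f" and L: "L = (\<lambda>A. f A + c)"
    using assms by (auto simp: affine_map_def)
  have fA: "f A = (\<Sum>a\<in>UNIV. \<Sum>i\<in>UNIV. A $ a $ i *\<^sub>R f (axis a (axis i 1)))" for A
    by (subst matrix_expansion[of A]) (simp add: linear_sum[OF f] linear_scale[OF f])
  have "L A = inv_layer (\<chi> a i. f (axis a (axis i 1))) c A" for A
    unfolding L by (subst fA) (simp add: vec_eq_iff inv_layer_component mult.commute)
  then show thesis
    using that by blast
qed

lemma inv_layer_act:
  assumes "bij p"
  shows "inv_layer T Y (act p A) = inv_layer (\<chi> a. T $ (p \<circ> a)) Y A"
proof -
  have "(\<Sum>a\<in>UNIV. \<Sum>i\<in>UNIV. T $ a $ i $ i' * act p A $ a $ i)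
    = (\<Sum>a\<in>UNIV. \<Sum>i\<in>UNIV. T $ (p \<circ> a) $ i $ i' * A $ a $ i)" for i'
    by (rule sum_act[OF assms, of "\<lambda>a x. \<Sum>i\<in>UNIV. T $ a $ i $ i' * x $ i"])
  then show ?thesis
    by (simp only: vec_eq_iff inv_layer_component) simp
qed

text \<open>By \<open>inv_layer_act\<close>, invariance under \<open>p\<close> is an equation
  between two layers with the same bias, hence a condition on \<open>T\<close> alone.\<close>

lemma invariant_layers_iff_perm:
  "L \<in> invariant_layers
    \<longleftrightarrow> (\<exists>T Y. L = inv_layer T Y \<and> (\<forall>p a. bij p \<longrightarrow> T $ (p \<circ> a) = T $ a))"
proof -
  have "(\<forall>p A. bij p \<longrightarrow> inv_layer T Y (act p A) = inv_layer T Y A)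
    \<longleftrightarrow> (\<forall>p a. bij p \<longrightarrow> T $ (p \<circ> a) = T $ a)" for T Y
  proof -
    have "(\<forall>A. inv_layer T Y (act p A) = inv_layer T Y A)
      \<longleftrightarrow> (\<forall>a. T $ (p \<circ> a) = T $ a)" if "bij p" for p
    proof -
      have "(\<forall>A. inv_layer T Y (act p A) = inv_layer T Y A)
        \<longleftrightarrow> inv_layer (\<chi> a. T $ (p \<circ> a)) Y = inv_layer T Y"
        by (simp add: inv_layer_act[OF that] fun_eq_iff)
      then show ?thesis
        by (simp add: inv_layer_eq_iff vec_eq_iff)
    qed
    then show ?thesis
      by blast
  qed
  then show ?thesis
    unfolding invariant_layers_def by (auto simp: affine_map_inv_layer elim!: affine_mapE)
qed

section \<open>Expansion of invariant layers in indicator tensors\<close>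

lemma sum_delta2:
  fixes f :: "'d::finite \<Rightarrow> 'e::finite \<Rightarrow> real"
  shows "(\<Sum>j\<in>UNIV. \<Sum>j'\<in>UNIV. f j j' * (if P \<and> i = j \<and> i' = j' then 1 else 0))
    = (if P then f i i' else 0)"
proof -
  have "(\<Sum>j\<in>UNIV. \<Sum>j'\<in>UNIV. f j j' * (if P \<and> i = j \<and> i' = j' then 1 else 0))
    = (\<Sum>j\<in>UNIV. if i = j then if P then f i i' else 0 else 0)"
    by (intro sum.cong refl) (auto simp: if_distrib cong: if_cong)
  then show ?thesis
    by simp
qed

lemma sum_inv_B_component:
  "(\<Sum>l\<in>pattern_classes. \<Sum>j\<in>UNIV. \<Sum>j'\<in>UNIV. w l j j' *\<^sub>R inv_B l j j') $ a $ i $ i'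
    = w (same_pattern `` {a}) i i'"
  by (simp add: inv_B_def sum_delta2 sum_pattern_classes_delta[of a "\<lambda>l. w l i i'"])

lemma sum_inv_C_component: "(\<Sum>j'\<in>UNIV. b j' *\<^sub>R inv_C j') $ i' = b i'"
  by (simp add: inv_C_def if_distrib cong: if_cong)

lemma invariant_layers_iff_sum:
  "L \<in> invariant_layers \<longleftrightarrow>
    (\<exists>w b. L = inv_layer
      (\<Sum>l\<in>pattern_classes. \<Sum>j\<in>UNIV. \<Sum>j'\<in>UNIV. w l j j' *\<^sub>R inv_B l j j')
      (\<Sum>j'\<in>UNIV. b j' *\<^sub>R inv_C j'))"
  (is "_ \<longleftrightarrow> (\<exists>w b. L = inv_layer (?T w) (?Y b))")
proof
  assume "L \<in> invariant_layers"
  then obtain T Y where L: "L = inv_layer T Y"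
    and T: "\<And>p a. bij p \<Longrightarrow> T $ (p \<circ> a) = T $ a"
    unfolding invariant_layers_iff_perm by blast
  \<comment> \<open>The coefficient of a class is the entry of \<open>T\<close> at a chosen member;
    invariance makes it the entry at every member.\<close>
  let ?w = "\<lambda>X j j'. T $ (SOME a. a \<in> X) $ j $ j'" and ?b = "($) Y"
  have "T = ?T ?w"
    unfolding vec_eq_iff sum_inv_B_component
    by (simp add: perm_invariant_on_class[of "($) T", OF T] del: Image_singleton_iff)
  moreover have "Y = ?Y ?b"
    by (simp only: vec_eq_iff sum_inv_C_component) simp
  ultimately have "L = inv_layer (?T ?w) (?Y ?b)"
    unfolding L by (rule arg_cong2)
  then show "\<exists>w b. L = inv_layer (?T w) (?Y b)"
    by (intro exI)
next
  assume "\<exists>w b. L = inv_layer (?T w) (?Y b)"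
  then obtain w b where L: "L = inv_layer (?T w) (?Y b)"
    by blast
  have "?T w $ (p \<circ> a) = ?T w $ a" if "bij p" for p a
    using that by (simp only: vec_eq_iff sum_inv_B_component pattern_class_perm) simp
  then show "L \<in> invariant_layers"
    unfolding L invariant_layers_iff_perm by blast
qed

text \<open>Weight part and bias part each depend linearly on their tensor, so combining basis
  layers amounts to combining tensors.\<close>

lemma sum_inv_basis:
  "(\<Sum>x\<in>(pattern_classes \<times> UNIV \<times> UNIV) <+> UNIV. w x *\<^sub>R inv_basis x)
    = inv_layer
      (\<Sum>l\<in>pattern_classes. \<Sum>j\<in>UNIV. \<Sum>j'\<in>UNIV. w (Inl (l, j, j')) *\<^sub>R inv_B l j j')
      (\<Sum>j'\<in>UNIV. w (Inr j') *\<^sub>R inv_C j')"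
  by (subst inv_layer_split)
    (simp add: sum.Plus sum.cartesian_product' linear_sum[OF linear_inv_layer_weight]
      linear_scale[OF linear_inv_layer_weight] linear_sum[OF linear_inv_layer_bias]
      linear_scale[OF linear_inv_layer_bias] del: UNIV_Times_UNIV)

lemma basis_of_invariant_layers:
  "basis_of inv_basis ((pattern_classes \<times> UNIV \<times> UNIV) <+> UNIV)
    (invariant_layers ::
      (real ^ 'd::finite ^ ('k::finite \<Rightarrow> 'n::finite) \<Rightarrow> real ^ 'e::finite) set)"
proof (rule basis_ofI)
  fix w :: "(('k \<Rightarrow> 'n) set \<times> 'd \<times> 'e) + 'e \<Rightarrow> real"
    and x :: "(('k \<Rightarrow> 'n) set \<times> 'd \<times> 'e) + 'e"
  assume "(\<Sum>x\<in>(pattern_classes \<times> UNIV \<times> UNIV) <+> UNIV. w x *\<^sub>R inv_basis x) = 0"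
  then have *:
    "(\<Sum>l\<in>pattern_classes. \<Sum>j\<in>UNIV. \<Sum>j'\<in>UNIV. w (Inl (l, j, j')) *\<^sub>R inv_B l j j') = 0"
    "(\<Sum>j'\<in>UNIV. w (Inr j') *\<^sub>R inv_C j') = 0"
    unfolding sum_inv_basis inv_layer_zero[symmetric] inv_layer_eq_iff by blast+
  \<comment> \<open>The coefficient of a class is an entry of the combined weight tensor, which
    vanishes.\<close>
  have "w (Inl (same_pattern `` {a}, i, i')) = 0" for a i i'
    using sum_inv_B_component[of "\<lambda>l j j'. w (Inl (l, j, j'))" a i i'] by (simp add: *(1))
  moreover have "w (Inr i') = 0" for i'
    using sum_inv_C_component[of "\<lambda>j'. w (Inr j')" i'] by (simp add: *(2))
  moreover assume "x \<in> (pattern_classes \<times> UNIV \<times> UNIV) <+> UNIV"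
  ultimately show "w x = 0"
    by (auto elim!: pattern_classesE)
next
  show "invariant_layers = range (\<lambda>w :: (('k \<Rightarrow> 'n) set \<times> 'd \<times> 'e) + 'e \<Rightarrow> real.
    \<Sum>x\<in>(pattern_classes \<times> UNIV \<times> UNIV) <+> UNIV. w x *\<^sub>R inv_basis x)"
    (is "_ = range ?s")
  proof (intro equalityI subsetI)
    fix L :: "real ^ 'd ^ ('k \<Rightarrow> 'n) \<Rightarrow> real ^ 'e"
    assume "L \<in> invariant_layers"
    then obtain w b where "L = inv_layer
      (\<Sum>l\<in>pattern_classes. \<Sum>j\<in>UNIV. \<Sum>j'\<in>UNIV. w l j j' *\<^sub>R inv_B l j j')
      (\<Sum>j'\<in>UNIV. b j' *\<^sub>R inv_C j')"
      unfolding invariant_layers_iff_sum by blast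
    then have "L = ?s (case_sum (\<lambda>(l, j, j'). w l j j') b)"
      unfolding sum_inv_basis by simp
    then show "L \<in> range ?s"
      by blast
  qed (elim rangeE, simp only: sum_inv_basis invariant_layers_iff_sum, intro exI, rule refl)
qed simp

section \<open>Equivariant layers\<close>

text \<open>An equivariant layer is treated one output multi-index at a time, each slice being an affine
  map of the shape \<^const>\<open>inv_layer\<close>.\<close>

definition output_slice ::
  "'e ^ 'b ^ 'd ^ 'a \<Rightarrow> 'b \<Rightarrow> 'e ^ 'd ^ 'a" where
  "output_slice T b = (\<chi> a i. T $ a $ i $ b)"

lemma output_slice_component [simp]: "output_slice T b $ a $ i = T $ a $ i $ b"
  by (simp add: output_slice_def)

lemma equiv_layer_component: "equiv_layer T Y A $ b = inv_layer (output_slice T b) (Y $ b) A"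
  by (simp add: vec_eq_iff equiv_layer_def inv_layer_component)

lemma equiv_layer_eq_iff: "equiv_layer T Y = equiv_layer T' Y' \<longleftrightarrow> T = T' \<and> Y = Y'"
proof
  assume eq: "equiv_layer T Y = equiv_layer T' Y'"
  have "inv_layer (output_slice T b) (Y $ b) = inv_layer (output_slice T' b) (Y' $ b)" for b
    by (rule ext) (simp add: eq flip: equiv_layer_component)
  then show "T = T' \<and> Y = Y'"
    by (simp add: inv_layer_eq_iff vec_eq_iff)
qed simp

lemma equiv_layer_split: "equiv_layer T Y = equiv_layer T 0 + equiv_layer 0 Y"
  by (simp add: fun_eq_iff vec_eq_iff equiv_layer_def)

lemma linear_equiv_layer_weight: "linear (\<lambda>T. equiv_layer T 0)"
  by (rule linearI)
    (simp_all add: fun_eq_iff vec_eq_iff equiv_layer_def scaleR_fun_def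
      distrib_right sum.distrib sum_distrib_left mult.assoc)

lemma linear_equiv_layer_bias: "linear (equiv_layer 0)"
  by (rule linearI) (simp_all add: fun_eq_iff vec_eq_iff equiv_layer_def scaleR_fun_def)

lemma equiv_layer_zero: "equiv_layer 0 0 = 0"
  by (simp add: fun_eq_iff vec_eq_iff equiv_layer_def)

lemma affine_map_equiv_layer: "affine_map (equiv_layer T Y)"
  unfolding affine_map_def
proof (intro exI conjI)
  show "linear (equiv_layer T 0)"
    by (rule linearI)
      (simp_all add: vec_eq_iff equiv_layer_def distrib_left sum.distrib sum_distrib_left
        mult.left_commute)
  show "equiv_layer T Y = (\<lambda>A. equiv_layer T 0 A + Y)"
    by (simp add: fun_eq_iff vec_eq_iff equiv_layer_def)
qed

text \<open>Each output component is affine and so is covered by \<open>affine_mapE\<close>; the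
  tensors chosen for the components are then stacked.\<close>

lemma affine_map_equivE:
  fixes L :: "real ^ 'd::finite ^ ('k::finite \<Rightarrow> 'n::finite) \<Rightarrow> real ^ 'e::finite ^ ('k \<Rightarrow> 'n)"
  assumes "affine_map L"
  obtains T Y where "L = equiv_layer T Y"
proof -
  have "affine_map (\<lambda>A. L A $ b)" for b
  proof -
    obtain f c where f: "linear f" and L: "L = (\<lambda>A. f A + c)"
      using assms by (auto simp: affine_map_def)
    have "linear (\<lambda>A. f A $ b)"
      by (rule linearI) (simp_all add: linear_add[OF f] linear_scale[OF f])
    then show ?thesis
      unfolding affine_map_def L by (intro exI[of _ "\<lambda>A. f A $ b"] exI[of _ "c $ b"]) simp
  qed
  then have "\<exists>T Y. (\<lambda>A. L A $ b) = inv_layer T Y" for b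
    by (metis affine_mapE)
  then obtain T Y where TY: "\<And>b. (\<lambda>A. L A $ b) = inv_layer (T b) (Y b)"
    by metis
  have slice: "output_slice (\<chi> a i b. T b $ a $ i) b = T b" for b
    by (simp add: vec_eq_iff)
  have "L A = equiv_layer (\<chi> a i b. T b $ a $ i) (\<chi> b. Y b) A" for A
    by (subst vec_eq_iff) (use fun_cong[OF TY] in \<open>simp add: equiv_layer_component slice\<close>)
  then have "L = equiv_layer (\<chi> a i b. T b $ a $ i) (\<chi> b. Y b)"
    by (rule ext)
  then show thesis
    by (rule that)
qed

text \<open>Equivariance permutes input and output together: weights are invariant under
  simultaneous permutation of both multi-indices, biases under permutation of the output
  one.\<close>

lemma equivariant_layers_iff_perm:
  fixes L :: "real ^ 'd::finite ^ ('k::finite \<Rightarrow> 'n::finite) \<Rightarrow> real ^ 'e::finite ^ ('k \<Rightarrow> 'n)"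
  shows
    "L \<in> equivariant_layers \<longleftrightarrow>
    (\<exists>T Y. L = equiv_layer T Y \<and>
      (\<forall>p a i b. bij p \<longrightarrow> T $ (p \<circ> a) $ i $ (p \<circ> b) = T $ a $ i $ b) \<and>
      (\<forall>p b. bij p \<longrightarrow> Y $ (p \<circ> b) = Y $ b))"
proof -
  have "L \<in> equivariant_layers \<longleftrightarrow> (\<exists>T Y. L = equiv_layer T Y \<and>
    (\<forall>p A. bij p \<longrightarrow> equiv_layer T Y (act p A) = act p (equiv_layer T Y A)))"
    unfolding equivariant_layers_def
    by (auto simp: affine_map_equiv_layer elim!: affine_map_equivE)
  moreover
  have "(\<forall>p A. bij p \<longrightarrow> equiv_layer T Y (act p A) = act p (equiv_layer T Y A)) \<longleftrightarrow>
    (\<forall>p a i b. bij p \<longrightarrow> T $ (p \<circ> a) $ i $ (p \<circ> b) = T $ a $ i $ b) \<and>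
    (\<forall>p b. bij p \<longrightarrow> Y $ (p \<circ> b) = Y $ b)"
    for T :: "real ^ 'e ^ ('k \<Rightarrow> 'n) ^ 'd ^ ('k \<Rightarrow> 'n)" and Y
  proof -
    have "(\<forall>A. equiv_layer T Y (act p A) = act p (equiv_layer T Y A)) \<longleftrightarrow>
      (\<forall>a i b. T $ (p \<circ> a) $ i $ (p \<circ> b) = T $ a $ i $ b) \<and> (\<forall>b. Y $ (p \<circ> b) = Y $ b)"
      (is "?lhs \<longleftrightarrow> ?rhs") if p: "bij p" for p
    proof -
      \<comment> \<open>Reading the output at \<open>p \<circ> b\<close> cancels the action on the
        right-hand side, so output indices can be treated separately.\<close>
      have "?lhs \<longleftrightarrow> (\<forall>A b. equiv_layer T Y (act p A) $ (p \<circ> b) = equiv_layer T Y A $ b)"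
      proof
        assume ?lhs
        then show "\<forall>A b. equiv_layer T Y (act p A) $ (p \<circ> b) = equiv_layer T Y A $ b"
          by (metis act_nth[OF p])
      next
        assume *: "\<forall>A b. equiv_layer T Y (act p A) $ (p \<circ> b) = equiv_layer T Y A $ b"
        have "p \<circ> (inv p \<circ> b) = b" for b :: "'k \<Rightarrow> 'n"
          using p by (simp add: fun_eq_iff bij_is_surj surj_f_inv_f)
        then have "equiv_layer T Y (act p A) $ b = act p (equiv_layer T Y A) $ b" for A b
          using *[rule_format, of A "inv p \<circ> b"] by simp
        then show ?lhs
          by (subst vec_eq_iff) blast
      qed
      \<comment> \<open>For fixed \<open>b\<close>, agreement on all inputs is an equality of two
        slices, whose tensors can be compared.\<close>
      also have "\<dots> \<longleftrightarrow> (\<forall>b. inv_layer (\<chi> a. output_slice T (p \<circ> b) $ (p \<circ> a)) (Y $ (p \<circ> b))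
        = inv_layer (output_slice T b) (Y $ b))"
        by (auto simp: fun_eq_iff[of "inv_layer _ _"] equiv_layer_component inv_layer_act[OF p])
      also have "\<dots> \<longleftrightarrow> ?rhs"
        by (auto simp: inv_layer_eq_iff vec_eq_iff)
      finally show ?thesis .
    qed
    then show ?thesis
      by blast
  qed
  ultimately show ?thesis
    by simp
qed

section \<open>Expansion of equivariant layers in indicator tensors\<close>

lemma comp_case_sum: "p \<circ> case_sum a b = case_sum (p \<circ> a) (p \<circ> b)"
  by (simp add: fun_eq_iff split: sum.split)

lemma case_sum_Inl_Inr: "case_sum (c \<circ> Inl) (c \<circ> Inr) = c"
  by (simp add: fun_eq_iff split: sum.split)

lemma sum_equiv_B_component:
  "(\<Sum>m\<in>pattern_classes. \<Sum>j\<in>UNIV. \<Sum>j'\<in>UNIV. w m j j' *\<^sub>R equiv_B m j j') $ a $ i $ b $ i'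
    = w (same_pattern `` {case_sum a b}) i i'"
  by (simp add: equiv_B_def sum_delta2
      sum_pattern_classes_delta[of "case_sum a b" "\<lambda>m. w m i i'"])

lemma sum_equiv_C_component:
  "(\<Sum>l\<in>pattern_classes. \<Sum>j'\<in>UNIV. c l j' *\<^sub>R equiv_C l j') $ b $ i'
    = c (same_pattern `` {b}) i'"
proof -
  have "(\<Sum>j'\<in>UNIV. c l j' * (if b \<in> l \<and> i' = j' then 1 else 0)) = (if b \<in> l then c l i' else 0)"
    for l
    by (auto simp: if_distrib cong: if_cong)
  then show ?thesis
    by (simp add: equiv_C_def sum_pattern_classes_delta[of b "\<lambda>l. c l i'"])
qed

lemma equivariant_layers_iff_sum:
  "L \<in> equivariant_layers \<longleftrightarrow>
    (\<exists>w b. L = equiv_layer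
      (\<Sum>m\<in>pattern_classes. \<Sum>j\<in>UNIV. \<Sum>j'\<in>UNIV. w m j j' *\<^sub>R equiv_B m j j')
      (\<Sum>l\<in>pattern_classes. \<Sum>j'\<in>UNIV. b l j' *\<^sub>R equiv_C l j'))"
  (is "_ \<longleftrightarrow> (\<exists>w b. L = equiv_layer (?T w) (?Y b))")
proof
  assume "L \<in> equivariant_layers"
  then obtain T Y where L: "L = equiv_layer T Y"
    and T: "\<And>p a i b. bij p \<Longrightarrow> T $ (p \<circ> a) $ i $ (p \<circ> b) = T $ a $ i $ b"
    and Y: "\<And>p b. bij p \<Longrightarrow> Y $ (p \<circ> b) = Y $ b"
    unfolding equivariant_layers_iff_perm by blast
  \<comment> \<open>\<open>t\<close> is the weight tensor as a function of the concatenated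
    multi-index. Permuting the values of \<open>c\<close> permutes both halves at once, so the
    symmetry of \<open>T\<close> is plain permutation invariance of \<open>t\<close>.\<close>
  define t where "t c j j' = T $ (c \<circ> Inl) $ j $ (c \<circ> Inr) $ j'" for c and j j'
  have t_class: "t (SOME c. c \<in> same_pattern `` {c'}) = t c'" for c'
    by (rule perm_invariant_on_class[of t], intro ext, unfold t_def comp_assoc, simp only: T)
  have t_case_sum: "t (case_sum a b) j j' = T $ a $ j $ b $ j'" for a b j j'
    by (simp add: t_def case_sum_o_inj)
  let ?w = "\<lambda>X. t (SOME c. c \<in> X)" and ?b = "\<lambda>X j'. Y $ (SOME b. b \<in> X) $ j'"
  have "T = ?T ?w"
    unfolding vec_eq_iff sum_equiv_B_component by (simp add: t_class t_case_sum del: Image_singleton_iff)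
  moreover have "Y = ?Y ?b"
    unfolding vec_eq_iff sum_equiv_C_component
    by (simp add: perm_invariant_on_class[of "($) Y", OF Y] del: Image_singleton_iff)
  ultimately have "L = equiv_layer (?T ?w) (?Y ?b)"
    unfolding L by (rule arg_cong2)
  then show "\<exists>w b. L = equiv_layer (?T w) (?Y b)"
    by (intro exI)
next
  assume "\<exists>w b. L = equiv_layer (?T w) (?Y b)"
  then obtain w c where L: "L = equiv_layer (?T w) (?Y c)"
    by blast
  \<comment> \<open>Permuting both halves permutes the concatenation, which stays in its
    class.\<close>
  have "?T w $ (p \<circ> a) $ i $ (p \<circ> b) = ?T w $ a $ i $ b" if "bij p" for p a i b
    unfolding vec_eq_iff sum_equiv_B_component comp_case_sum[symmetric] pattern_class_perm[OF that]
    by simp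
  moreover have "?Y c $ (p \<circ> b) = ?Y c $ b" if "bij p" for p b
    unfolding vec_eq_iff sum_equiv_C_component pattern_class_perm[OF that] by simp
  ultimately show "L \<in> equivariant_layers"
    unfolding L equivariant_layers_iff_perm by blast
qed

lemma sum_equiv_basis:
  "(\<Sum>x\<in>(pattern_classes \<times> UNIV \<times> UNIV) <+> (pattern_classes \<times> UNIV). w x *\<^sub>R equiv_basis x)
    = equiv_layer
      (\<Sum>m\<in>pattern_classes. \<Sum>j\<in>UNIV. \<Sum>j'\<in>UNIV. w (Inl (m, j, j')) *\<^sub>R equiv_B m j j')
      (\<Sum>l\<in>pattern_classes. \<Sum>j'\<in>UNIV. w (Inr (l, j')) *\<^sub>R equiv_C l j')"
  by (subst equiv_layer_split)
    (simp add: sum.Plus sum.cartesian_product' linear_sum[OF linear_equiv_layer_weight]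
      linear_scale[OF linear_equiv_layer_weight] linear_sum[OF linear_equiv_layer_bias]
      linear_scale[OF linear_equiv_layer_bias] del: UNIV_Times_UNIV)

lemma basis_of_equivariant_layers:
  "basis_of equiv_basis ((pattern_classes \<times> UNIV \<times> UNIV) <+> (pattern_classes \<times> UNIV))
    (equivariant_layers ::
      (real ^ 'd::finite ^ ('k::finite \<Rightarrow> 'n::finite) \<Rightarrow> real ^ 'e::finite ^ ('k \<Rightarrow> 'n)) set)"
proof (rule basis_ofI)
  fix w :: "(('k + 'k \<Rightarrow> 'n) set \<times> 'd \<times> 'e) + (('k \<Rightarrow> 'n) set \<times> 'e) \<Rightarrow> real"
    and x :: "(('k + 'k \<Rightarrow> 'n) set \<times> 'd \<times> 'e) + (('k \<Rightarrow> 'n) set \<times> 'e)"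
  assume "(\<Sum>x\<in>(pattern_classes \<times> UNIV \<times> UNIV) <+> (pattern_classes \<times> UNIV).
    w x *\<^sub>R equiv_basis x) = 0"
  then have *:
    "(\<Sum>m\<in>pattern_classes. \<Sum>j\<in>UNIV. \<Sum>j'\<in>UNIV. w (Inl (m, j, j')) *\<^sub>R equiv_B m j j') = 0"
    "(\<Sum>l\<in>pattern_classes. \<Sum>j'\<in>UNIV. w (Inr (l, j')) *\<^sub>R equiv_C l j') = 0"
    unfolding sum_equiv_basis equiv_layer_zero[symmetric] equiv_layer_eq_iff by blast+
  \<comment> \<open>Every \<open>c\<close> is the concatenation of its halves, so all weight
    coefficients are reached.\<close>
  have "w (Inl (same_pattern `` {c}, i, i')) = 0" for c i i'
    using sum_equiv_B_component[of "\<lambda>m j j'. w (Inl (m, j, j'))" "c \<circ> Inl" i "c \<circ> Inr" i']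
    by (simp add: *(1) case_sum_Inl_Inr)
  moreover have "w (Inr (same_pattern `` {b}, i')) = 0" for b i'
    using sum_equiv_C_component[of "\<lambda>l j'. w (Inr (l, j'))" b i'] by (simp add: *(2))
  moreover assume "x \<in> (pattern_classes \<times> UNIV \<times> UNIV) <+> (pattern_classes \<times> UNIV)"
  ultimately show "w x = 0"
    by (auto elim!: pattern_classesE)
next
  show "equivariant_layers
    = range (\<lambda>w :: (('k + 'k \<Rightarrow> 'n) set \<times> 'd \<times> 'e) + (('k \<Rightarrow> 'n) set \<times> 'e) \<Rightarrow> real.
      \<Sum>x\<in>(pattern_classes \<times> UNIV \<times> UNIV) <+> (pattern_classes \<times> UNIV). w x *\<^sub>R equiv_basis x)"
    (is "_ = range ?s")
  proof (intro equalityI subsetI)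
    fix L :: "real ^ 'd ^ ('k \<Rightarrow> 'n) \<Rightarrow> real ^ 'e ^ ('k \<Rightarrow> 'n)"
    assume "L \<in> equivariant_layers"
    then obtain w b where "L = equiv_layer
      (\<Sum>m\<in>pattern_classes. \<Sum>j\<in>UNIV. \<Sum>j'\<in>UNIV. w m j j' *\<^sub>R equiv_B m j j')
      (\<Sum>l\<in>pattern_classes. \<Sum>j'\<in>UNIV. b l j' *\<^sub>R equiv_C l j')"
      unfolding equivariant_layers_iff_sum by blast
    then have "L = ?s (case_sum (\<lambda>(m, j, j'). w m j j') (\<lambda>(l, j'). b l j'))"
      unfolding sum_equiv_basis by simp
    then show "L \<in> range ?s"
      by blast
  qed (elim rangeE, simp only: sum_equiv_basis equivariant_layers_iff_sum, intro exI, rule refl)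
qed simp

(* There are Bell l equality patterns in [n]^l if l \<le> n, and strictly fewer if l > n. Hence the
   dimensions are given by the number of classes for every n, and by Bell numbers under
   k \<le> n (invariant case) and 2 k \<le> n (equivariant case). *)

theorem theorem2:
  shows
    "((CARD('k) \<le> CARD('n) \<longrightarrow>
          dim (invariant_layers ::
              (real ^ 'd::finite ^ ('k::finite \<Rightarrow> 'n::finite) \<Rightarrow> real ^ 'e::finite) set)
            = CARD('d) * CARD('e) * Bell CARD('k) + CARD('e)) \<and>
      dim (invariant_layers :: (real ^ 'd ^ ('k \<Rightarrow> 'n) \<Rightarrow> real ^ 'e) set)
        = CARD('d) * CARD('e) * card (pattern_classes :: ('k \<Rightarrow> 'n) set set) + CARD('e) \<and>
      basis_of inv_basis ((pattern_classes \<times> UNIV \<times> UNIV) <+> UNIV)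
        (invariant_layers :: (real ^ 'd ^ ('k \<Rightarrow> 'n) \<Rightarrow> real ^ 'e) set) \<and>
      (\<forall>L :: real ^ 'd ^ ('k \<Rightarrow> 'n) \<Rightarrow> real ^ 'e. L \<in> invariant_layers \<longleftrightarrow>
        (\<exists>w b. L = inv_layer
          (\<Sum>l\<in>pattern_classes. \<Sum>j\<in>UNIV. \<Sum>j'\<in>UNIV. w l j j' *\<^sub>R inv_B l j j')
          (\<Sum>j'\<in>UNIV. b j' *\<^sub>R inv_C j')))) \<and>
     ((2 * CARD('k) \<le> CARD('n) \<longrightarrow>
          dim (equivariant_layers :: (real ^ 'd ^ ('k \<Rightarrow> 'n) \<Rightarrow> real ^ 'e ^ ('k \<Rightarrow> 'n)) set)
            = CARD('d) * CARD('e) * Bell (2 * CARD('k)) + CARD('e) * Bell CARD('k)) \<and>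
      dim (equivariant_layers :: (real ^ 'd ^ ('k \<Rightarrow> 'n) \<Rightarrow> real ^ 'e ^ ('k \<Rightarrow> 'n)) set)
        = CARD('d) * CARD('e) * card (pattern_classes :: ('k + 'k \<Rightarrow> 'n) set set)
          + CARD('e) * card (pattern_classes :: ('k \<Rightarrow> 'n) set set) \<and>
      basis_of equiv_basis
        ((pattern_classes \<times> UNIV \<times> UNIV) <+> (pattern_classes \<times> UNIV))
        (equivariant_layers :: (real ^ 'd ^ ('k \<Rightarrow> 'n) \<Rightarrow> real ^ 'e ^ ('k \<Rightarrow> 'n)) set) \<and>
      (\<forall>L :: real ^ 'd ^ ('k \<Rightarrow> 'n) \<Rightarrow> real ^ 'e ^ ('k \<Rightarrow> 'n). L \<in> equivariant_layers \<longleftrightarrow>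
        (\<exists>w b. L = equiv_layer
          (\<Sum>m\<in>pattern_classes. \<Sum>j\<in>UNIV. \<Sum>j'\<in>UNIV. w m j j' *\<^sub>R equiv_B m j j')
          (\<Sum>l\<in>pattern_classes. \<Sum>j'\<in>UNIV. b l j' *\<^sub>R equiv_C l j'))))"
proof -
  have inv: "dim (invariant_layers :: (real ^ 'd ^ ('k \<Rightarrow> 'n) \<Rightarrow> real ^ 'e) set)
    = CARD('d) * CARD('e) * card (pattern_classes :: ('k \<Rightarrow> 'n) set set) + CARD('e)"
    by (subst dim_basis_of[OF basis_of_invariant_layers])
      (simp add: card_Plus card_cartesian_product ac_simps)
  have equiv: "dim (equivariant_layers :: (real ^ 'd ^ ('k \<Rightarrow> 'n) \<Rightarrow> real ^ 'e ^ ('k \<Rightarrow> 'n)) set)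
    = CARD('d) * CARD('e) * card (pattern_classes :: ('k + 'k \<Rightarrow> 'n) set set)
      + CARD('e) * card (pattern_classes :: ('k \<Rightarrow> 'n) set set)"
    by (subst dim_basis_of[OF basis_of_equivariant_layers])
      (simp add: card_Plus card_cartesian_product ac_simps)
  \<comment> \<open>This also serves the equivariant bias, since 2k \<le> n implies k \<le>
    n.\<close>
  have k: "card (pattern_classes :: ('k \<Rightarrow> 'n) set set) = Bell CARD('k)"
    if "CARD('k) \<le> CARD('n)"
    using that by (rule card_pattern_classes)
  have kk: "card (pattern_classes :: ('k + 'k \<Rightarrow> 'n) set set) = Bell (2 * CARD('k))"
    if "2 * CARD('k) \<le> CARD('n)"
    using card_pattern_classes[where 'l = "'k + 'k" and 'n = 'n] that by (simp add: mult_2)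
  show ?thesis
    by (intro conjI impI allI basis_of_invariant_layers basis_of_equivariant_layers
        invariant_layers_iff_sum equivariant_layers_iff_sum) (simp_all add: inv equiv k kk)
qed

end
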